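(* Let $G$ be a graph and let $z_0\in V(G)$ be a vertex. (i) $G$ is $\langle\mathbb{Z}_3\rangle$-extendable at $z_0$ if and only if $G-z_0$ is $\mathbb{Z}_3$-connected. (ii) If $G$ is $\langle\mathbb{Z}_3\rangle$-extendable at $z_0$, then $G$ is $\mathbb{Z}_3$-connected.
   Context: Graphs are finite, have no loops, and may have multiple edges. For an orientation $D$, $d_D^+(v)$ and $d_D^-(v)$ denote the out-degree and in-degree of $v$. A zero-sum function of $G$ is a map $\beta: V(G)\to\mathbb{Z}_3$ with $\sum_{v\in V(G)}\beta(v)=0$ in $\mathbb{Z}_3$; a $\beta$-orientation of $G$ is an orientation $D$ of $G$ with $d_D^+(v)-d_D^-(v)=\beta(v)$ in $\mathbb{Z}_3$ for every $v\in V(G)$. $G$ is $\mathbb{Z}_3$-connected if it admits a $\beta$-orientation for every zero-sum function $\beta$ of $G$. $E_G(z_0)$ is the set of edges incident with $z_0$; a pre-orientation $D_{z_0}$ of $E_G(z_0)$ is an orientation of just these edges. $G$ is $\langle\mathbb{Z}_3\rangle$-extendable at $z_0$ if for every zero-sum function $\beta$ of $G$ and every pre-orientation $D_{z_0}$ of $E_G(z_0)$ with $d_{D_{z_0}}^+(z_0)-d_{D_{z_0}}^-(z_0)\equiv\beta(z_0)\pmod 3$, $D_{z_0}$ can be extended to a $\beta$-orientation of $G$.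
   Formalization: Part (ii) is false as printed when z_0 has degree at most 1 and G has another vertex (e.g. G = K_2 with beta = 0); it is stated here under the added assumption that z_0 is the only vertex of G or has degree at least 2, which Z_3-connectedness of G itself implies. *)

theory Defs
  imports "Graph_Theory.Digraph" "HOL-Library.Numeral_Type"
begin

(* Undirected graphs with multiple edges: edges are abstract names, so distinct
   edges may have the same pair of ends. *)
record ('v, 'e) multigraph =
  vertices :: "'v set"
  edges :: "'e set"
  ends :: "'e \<Rightarrow> 'v set"

definition finite_loopless :: "('v, 'e) multigraph \<Rightarrow> bool" where
  "finite_loopless G \<longleftrightarrow> finite (vertices G) \<and> finite (edges G) \<and>
     (\<forall>e\<in>edges G. ends G e \<subseteq> vertices G \<and> card (ends G e) = 2)"

definition incident_edges :: "('v, 'e) multigraph \<Rightarrow> 'v \<Rightarrow> 'e set" where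
  "incident_edges G z = {e \<in> edges G. z \<in> ends G e}"

definition remove_vertex :: "('v, 'e) multigraph \<Rightarrow> 'v \<Rightarrow> ('v, 'e) multigraph" where
  "remove_vertex G z =
     \<lparr>vertices = vertices G - {z}, edges = edges G - incident_edges G z, ends = ends G\<rparr>"

(* An orientation of an edge set F of G is a digraph on all vertices of G whose arcs are
   the edges in F; F = edges G gives the orientations of G, and F = incident_edges G z
   the pre-orientations at z. Degrees are out_degree and in_degree of this digraph. *)
definition orients :: "('v, 'e) pre_digraph \<Rightarrow> ('v, 'e) multigraph \<Rightarrow> 'e set \<Rightarrow> bool" where
  "orients D G F \<longleftrightarrow> verts D = vertices G \<and> arcs D = F \<and>
     (\<forall>e\<in>F. {tail D e, head D e} = ends G e)"

(* The type 3 of Numeral_Type is the ring of integers modulo 3. *)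
definition balance :: "('v, 'e) pre_digraph \<Rightarrow> 'v \<Rightarrow> 3" where
  "balance D v = of_nat (out_degree D v) - of_nat (in_degree D v)"

(* Only the values of \<beta> on the vertices of G are relevant. *)
definition zero_sum :: "('v, 'e) multigraph \<Rightarrow> ('v \<Rightarrow> 3) \<Rightarrow> bool" where
  "zero_sum G \<beta> \<longleftrightarrow> (\<Sum>v\<in>vertices G. \<beta> v) = 0"

definition beta_orientation ::
  "('v, 'e) multigraph \<Rightarrow> ('v \<Rightarrow> 3) \<Rightarrow> ('v, 'e) pre_digraph \<Rightarrow> bool" where
  "beta_orientation G \<beta> D \<longleftrightarrow>
     orients D G (edges G) \<and> (\<forall>v\<in>vertices G. balance D v = \<beta> v)"

definition Z3_connected :: "('v, 'e) multigraph \<Rightarrow> bool" where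
  "Z3_connected G \<longleftrightarrow> (\<forall>\<beta>. zero_sum G \<beta> \<longrightarrow> (\<exists>D. beta_orientation G \<beta> D))"

(* Unlike subgraph and compatible, this ignores the values of tail and head outside
   the arcs of D'. *)
definition extends :: "('v, 'e) pre_digraph \<Rightarrow> ('v, 'e) pre_digraph \<Rightarrow> bool" where
  "extends D D' \<longleftrightarrow> verts D' \<subseteq> verts D \<and> arcs D' \<subseteq> arcs D \<and>
     (\<forall>e\<in>arcs D'. tail D e = tail D' e \<and> head D e = head D' e)"

definition Z3_extendable_at :: "('v, 'e) multigraph \<Rightarrow> 'v \<Rightarrow> bool" where
  "Z3_extendable_at G z \<longleftrightarrow>
     (\<forall>\<beta> D'. zero_sum G \<beta> \<and> orients D' G (incident_edges G z) \<and> balance D' z = \<beta> z \<longrightarrow>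
        (\<exists>D. beta_orientation G \<beta> D \<and> extends D D'))"

(* Extendability at z says nothing about those \<beta> for which no pre-orientation at z has
   balance \<beta> z. Such \<beta> exist if z has degree at most 1 and is not the only vertex, and
   then extendability does not imply connectedness: *)
lemma extendable_not_connected_example:
  defines "G \<equiv> \<lparr>vertices = UNIV, edges = {}, ends = (\<lambda>_. {})\<rparr> :: (bool, unit) multigraph"
  shows "finite_loopless G" "Z3_extendable_at G True" "\<not> Z3_connected G"
proof -
  show "finite_loopless G"
    by (simp add: G_def finite_loopless_def)
  have bal: "balance D v = 0" if "arcs D = {}" for D :: "(bool, unit) pre_digraph" and v
    using that
    by (simp add: balance_def out_degree_def in_degree_def out_arcs_def in_arcs_def)
  have "beta_orientation G \<beta> D \<and> extends D D"
    if "zero_sum G \<beta>" "orients D G (incident_edges G True)" "balance D True = \<beta> True"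
    for \<beta> D
  proof -
    have "arcs D = {}"
      using that(2) by (simp add: orients_def G_def incident_edges_def)
    then show ?thesis
      using that bal[of D]
      by (auto simp: beta_orientation_def extends_def orients_def zero_sum_def G_def
          UNIV_bool incident_edges_def)
  qed
  then show "Z3_extendable_at G True"
    unfolding Z3_extendable_at_def by blast
  show "\<not> Z3_connected G"
  proof
    assume "Z3_connected G"
    moreover have "zero_sum G (\<lambda>v. if v then 1 else - 1)"
      by (simp add: zero_sum_def G_def UNIV_bool)
    ultimately obtain D where "beta_orientation G (\<lambda>v. if v then 1 else - 1) D"
      unfolding Z3_connected_def by blast
    then have "arcs D = {}" "balance D True = 1"
      by (auto simp: beta_orientation_def orients_def G_def)
    then show False
      using bal[of D True] by simp
  qed
qed

(* The degree condition that excludes this is necessary for connectedness: *)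
lemma Z3_connected_imp_degree:
  assumes G: "finite_loopless G" and z: "z \<in> vertices G" and conn: "Z3_connected G"
  shows "vertices G = {z} \<or> 2 \<le> card (incident_edges G z)"
proof (rule ccontr)
  assume "\<not> ?thesis"
  then have small: "card (incident_edges G z) \<le> 1" and "vertices G \<noteq> {z}"
    by auto
  then obtain w where w: "w \<in> vertices G" "w \<noteq> z"
    using z by blast
  have fin: "finite (vertices G)" "finite (edges G)"
    using G by (auto simp: finite_loopless_def)
  have attained: "\<exists>D. orients D G (edges G) \<and> balance D z = a" for a :: 3
  proof -
    define \<beta> where "\<beta> = (\<lambda>v. if v = z then a else if v = w then - a else 0)"
    have "(\<Sum>v\<in>vertices G. \<beta> v) = (\<Sum>v\<in>{z, w}. \<beta> v)"
      using fin z w by (intro sum.mono_neutral_right) (auto simp: \<beta>_def)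
    then have "zero_sum G \<beta>"
      using w by (simp add: zero_sum_def \<beta>_def)
    then obtain D where "beta_orientation G \<beta> D"
      using conn unfolding Z3_connected_def by blast
    then show ?thesis
      using z by (auto simp: beta_orientation_def \<beta>_def)
  qed
  have deg: "out_degree D z + in_degree D z = card (incident_edges G z)"
    if D: "orients D G (edges G)" for D
  proof -
    have "tail D e \<noteq> head D e" if "e \<in> edges G" for e
    proof
      assume "tail D e = head D e"
      then have "ends G e = {tail D e}"
        using D that unfolding orients_def by (metis insert_absorb2)
      then show False
        using G that by (auto simp: finite_loopless_def)
    qed
    then have "out_arcs D z \<inter> in_arcs D z = {}"
      using D by (fastforce simp: orients_def out_arcs_def in_arcs_def)
    moreover have "incident_edges G z = out_arcs D z \<union> in_arcs D z"
    proof -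
      have "z \<in> ends G e \<longleftrightarrow> tail D e = z \<or> head D e = z" if "e \<in> edges G" for e
      proof -
        have "ends G e = {tail D e, head D e}"
          using D that by (simp add: orients_def)
        then show ?thesis
          by auto
      qed
      then show ?thesis
        using D by (auto simp: orients_def out_arcs_def in_arcs_def incident_edges_def)
    qed
    moreover have "finite (out_arcs D z)" "finite (in_arcs D z)"
      using D fin by (auto simp: orients_def out_arcs_def in_arcs_def)
    ultimately show ?thesis
      by (simp add: card_Un_disjoint out_degree_def in_degree_def)
  qed
  obtain D0 D1 where D: "orients D0 G (edges G)" "balance D0 z = 0"
      "orients D1 G (edges G)" "balance D1 z = 1"
    using attained by metis
  show False
  proof (cases "card (incident_edges G z) = 0")
    case True
    then show False
      using deg[OF D(3)] D(4) by (simp add: balance_def)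
  next
    case False
    then have "out_degree D0 z + in_degree D0 z = 1"
      using deg[OF D(1)] small by simp
    then consider "out_degree D0 z = 1" "in_degree D0 z = 0"
      | "out_degree D0 z = 0" "in_degree D0 z = 1"
      by linarith
    then show False
      using D(2) by cases (simp_all add: balance_def)
  qed
qed

end

(* The edges of G split into the edges at z0 and the edges of G - z0, and balances are additive
   under this splitting. Hence the extensions of a pre-orientation D' at z0 to a \<beta>-orientation
   of G correspond to the orientations of G - z0 with boundary \<beta> - balance D'. For (ii), turning
   k of the d edges at z0 outwards gives z0 the balance 2k - d = -(k + d) modulo 3, so if d \<ge> 2
   then k = 0, 1, 2 attain all three residues. *)
theory Submission
  imports Defs
begin

text \<open>Each arc counts 1 at its tail and -1 at its head. Writing the balance as one sum over
  arcs makes splitting the arc set and double counting available.\<close>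

lemma balance_eq_sum:
  assumes "finite (arcs D)"
  shows "balance D v = (\<Sum>e\<in>arcs D. of_bool (tail D e = v) - of_bool (head D e = v))"
proof -
  have "{e \<in> arcs D. P e} = arcs D \<inter> {e. P e}" for P
    by auto
  then show ?thesis
    using assms
    by (simp add: balance_def out_degree_def in_degree_def out_arcs_def in_arcs_def
        sum_subtractf sum.If_cases of_bool_def)
qed

lemma balance_disjoint_union:
  assumes "finite (arcs D)" "extends D D\<^sub>1" "extends D D\<^sub>2"
    and "arcs D = arcs D\<^sub>1 \<union> arcs D\<^sub>2" "arcs D\<^sub>1 \<inter> arcs D\<^sub>2 = {}"
  shows "balance D v = balance D\<^sub>1 v + balance D\<^sub>2 v"
proof -
  have fin: "finite (arcs D\<^sub>1)" "finite (arcs D\<^sub>2)"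
    using assms(1,4) by auto
  have "balance D v = (\<Sum>e\<in>arcs D\<^sub>1. of_bool (tail D e = v) - of_bool (head D e = v))
      + (\<Sum>e\<in>arcs D\<^sub>2. of_bool (tail D e = v) - of_bool (head D e = v))"
    using fin assms(5) by (simp add: balance_eq_sum[OF assms(1)] assms(4) sum.union_disjoint)
  also have "\<dots> = balance D\<^sub>1 v + balance D\<^sub>2 v"
    using assms(2,3) by (simp add: balance_eq_sum fin extends_def)
  finally show ?thesis .
qed

text \<open>Double counting: after swapping the sums, each arc contributes 1 - 1, since both its
  ends are vertices of \<open>G\<close>. This keeps functions zero-sum when a balance is added or
  subtracted.\<close>

lemma sum_balance_eq_0:
  assumes "finite_loopless G" "F \<subseteq> edges G" "orients D G F"
  shows "(\<Sum>v\<in>vertices G. balance D v) = 0"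
proof -
  have fin: "finite (vertices G)" "finite (arcs D)"
    using assms by (auto simp: finite_loopless_def orients_def intro: finite_subset)
  have ends: "tail D e \<in> vertices G" "head D e \<in> vertices G" if "e \<in> arcs D" for e
    using assms that unfolding finite_loopless_def orients_def by blast+
  have "(\<Sum>v\<in>vertices G. balance D v) = (\<Sum>e\<in>arcs D.
      \<Sum>v\<in>vertices G. of_bool (tail D e = v) - of_bool (head D e = v))"
    by (simp add: balance_eq_sum fin) (rule sum.swap)
  also have "\<dots> = 0"
    using fin ends by (intro sum.neutral) (simp add: sum_subtractf of_bool_def)
  finally show ?thesis .
qed

lemma balance_not_vertex:
  assumes "finite_loopless G" "F \<subseteq> edges G" "orients D G F" "v \<notin> vertices G"
  shows "balance D v = 0"
proof -
  have "finite (arcs D)"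
    using assms by (auto simp: finite_loopless_def orients_def intro: finite_subset)
  moreover have "tail D e \<noteq> v" "head D e \<noteq> v" if "e \<in> arcs D" for e
    using assms that unfolding finite_loopless_def orients_def by blast+
  ultimately show ?thesis
    by (simp add: balance_eq_sum)
qed

lemma finite_loopless_remove_vertex:
  assumes "finite_loopless G"
  shows "finite_loopless (remove_vertex G z)"
  using assms by (auto simp: finite_loopless_def remove_vertex_def incident_edges_def)

text \<open>Turn the edges in \<open>S\<close> away from \<open>z\<close> and all other edges at
  \<open>z\<close> towards it.\<close>

lemma star_orientation_exists:
  assumes G: "finite_loopless G" and S: "S \<subseteq> incident_edges G z"
  shows "\<exists>D. orients D G (incident_edges G z) \<and>
    balance D z = of_nat (card S) - of_nat (card (incident_edges G z - S))"
proof -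
  let ?I = "incident_edges G z"
  \<comment> \<open>Without loops, each edge at \<open>z\<close> has a second end different from
    \<open>z\<close>, so it enters exactly one of the two degrees of \<open>z\<close>.\<close>
  have "\<exists>w. ends G e = {z, w} \<and> w \<noteq> z" if "e \<in> ?I" for e
  proof -
    have "card (ends G e) = 2" "z \<in> ends G e"
      using G that by (auto simp: finite_loopless_def incident_edges_def)
    then show ?thesis
      by (auto simp: card_2_iff)
  qed
  then obtain w where w: "ends G e = {z, w e}" "w e \<noteq> z" if "e \<in> ?I" for e
    by metis
  define D where "D = \<lparr>verts = vertices G, arcs = ?I,
    tail = (\<lambda>e. if e \<in> S then z else w e), head = (\<lambda>e. if e \<in> S then w e else z)\<rparr>"
  have "out_arcs D z = S" "in_arcs D z = ?I - S"
    using S w by (auto simp: D_def out_arcs_def in_arcs_def split: if_splits)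
  then have "balance D z = of_nat (card S) - of_nat (card (?I - S))"
    by (simp add: balance_def out_degree_def in_degree_def)
  moreover have "orients D G ?I"
    using w by (auto simp: orients_def D_def)
  ultimately show ?thesis
    by blast
qed

lemma ex_of_nat_eq_mod3:
  fixes x :: 3
  shows "\<exists>k\<le>2. of_nat k = x"
proof (cases x)
  case (of_int i)
  then show ?thesis
    by (intro exI[of _ "nat i"]) (simp add: nat_le_iff)
qed

lemma star_orientation_with_balance:
  assumes G: "finite_loopless G" and deg: "2 \<le> card (incident_edges G z)"
  shows "\<exists>D. orients D G (incident_edges G z) \<and> balance D z = b"
proof -
  let ?I = "incident_edges G z"
  \<comment> \<open>With d edges at \<open>z\<close>, k of them outward, the balance is k - (d - k)
    = 2k - d = -k - d modulo 3; solving for \<open>b\<close> gives this k. The bound 2 lets the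
    degree hypothesis supply k edges.\<close>
  obtain k where k: "k \<le> 2" "of_nat k = - (b + of_nat (card ?I))"
    using ex_of_nat_eq_mod3 by blast
  obtain S where S: "S \<subseteq> ?I" "card S = k" "finite S"
    by (rule obtain_subset_with_card_n[of k ?I]) (use k(1) deg in auto)
  obtain D where D: "orients D G ?I"
      "balance D z = of_nat (card S) - of_nat (card (?I - S))"
    using star_orientation_exists[OF G S(1)] by blast
  have three: "a + a = - a" for a :: 3
  proof -
    have "(3 :: 3) = 0"
      by simp
    then have "3 * a = 0"
      by (metis mult_zero_left)
    then show ?thesis
      by (simp add: eq_neg_iff_add_eq_0)
  qed
  have "balance D z = (of_nat k + of_nat k) - of_nat (card ?I)"
    using D S k deg by (simp add: card_Diff_subset of_nat_diff)
  also have "\<dots> = b"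
    unfolding three by (simp add: k)
  finally show ?thesis
    using D by blast
qed

lemma Z3_extendable_at_iff:
  assumes G: "finite_loopless G" and z: "z \<in> vertices G"
  shows "Z3_extendable_at G z \<longleftrightarrow> Z3_connected (remove_vertex G z)"
proof
  let ?I = "incident_edges G z" and ?H = "remove_vertex G z"
  have I: "?I \<subseteq> edges G"
    by (auto simp: incident_edges_def)
  have fin: "finite (vertices G)" "finite (edges G)"
    using G by (auto simp: finite_loopless_def)
  have H: "vertices ?H = vertices G - {z}" "edges ?H = edges G - ?I" "ends ?H = ends G"
    by (simp_all add: remove_vertex_def)
  show "Z3_connected ?H" if ext: "Z3_extendable_at G z"
    unfolding Z3_connected_def
  proof (intro allI impI)
    fix \<beta> assume \<beta>: "zero_sum ?H \<beta>"
    \<comment> \<open>Any pre-orientation serves; the empty set of outward edges supplies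
      one.\<close>
    obtain D' where D': "orients D' G ?I"
      using star_orientation_exists[OF G empty_subsetI] by blast
    \<comment> \<open>The shift by \<open>balance D'\<close> is undone when the edges at
      \<open>z\<close> are removed, leaving \<beta>. At \<open>z\<close>, where \<beta> is
      unconstrained, the value 0 makes \<open>D'\<close> admissible for \<gamma>.\<close>
    define \<gamma> where "\<gamma> = (\<lambda>v. balance D' v + (if v = z then 0 else \<beta> v))"
    have "(\<Sum>v\<in>vertices G. if v = z then 0 else \<beta> v) = 0"
      using \<beta> fin z by (simp add: sum.remove[of _ z] zero_sum_def H)
    then have "zero_sum G \<gamma>"
      using sum_balance_eq_0[OF G I D'] by (simp add: zero_sum_def \<gamma>_def sum.distrib)
    moreover have "balance D' z = \<gamma> z"
      by (simp add: \<gamma>_def)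
    ultimately obtain D where D: "beta_orientation G \<gamma> D" "extends D D'"
      using ext D' unfolding Z3_extendable_at_def by blast
    define D'' where "D'' = D\<lparr>verts := vertices ?H, arcs := edges ?H\<rparr>"
    have "balance D v = balance D' v + balance D'' v" for v
      using D D' I fin
      by (intro balance_disjoint_union)
        (auto simp: beta_orientation_def orients_def extends_def D''_def H)
    then have "balance D'' v = \<beta> v" if "v \<in> vertices ?H" for v
      using D that by (auto simp: beta_orientation_def \<gamma>_def H)
    moreover have "orients D'' ?H (edges ?H)"
      using D by (auto simp: beta_orientation_def orients_def D''_def H)
    ultimately show "\<exists>D. beta_orientation ?H \<beta> D"
      by (auto simp: beta_orientation_def)
  qed
  show "Z3_extendable_at G z" if conn: "Z3_connected ?H"
    unfolding Z3_extendable_at_def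
  proof (intro allI impI, elim conjE)
    fix \<beta> D' assume \<beta>: "zero_sum G \<beta>" and D': "orients D' G ?I" "balance D' z = \<beta> z"
    have "(\<Sum>v\<in>vertices G. \<beta> v - balance D' v) = 0"
      using \<beta> sum_balance_eq_0[OF G I D'(1)] by (simp add: zero_sum_def sum_subtractf)
    \<comment> \<open>The term at \<open>z\<close> vanishes because \<open>D'\<close> already has
      balance \<open>\<beta> z\<close> there.\<close>
    then have "zero_sum ?H (\<lambda>v. \<beta> v - balance D' v)"
      using fin z D'(2) by (simp add: sum.remove[of _ z] zero_sum_def H)
    then obtain D'' where "beta_orientation ?H (\<lambda>v. \<beta> v - balance D' v) D''"
      using conn unfolding Z3_connected_def by blast
    then have D'': "orients D'' ?H (edges ?H)"
        "\<And>v. v \<in> vertices ?H \<Longrightarrow> balance D'' v = \<beta> v - balance D' v"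
      by (auto simp: beta_orientation_def)
    \<comment> \<open>Glue \<open>D'\<close> on the edges at \<open>z\<close> to \<open>D''\<close>
      on the remaining edges.\<close>
    define D where "D = \<lparr>verts = vertices G, arcs = edges G,
      tail = (\<lambda>e. if e \<in> ?I then tail D' e else tail D'' e),
      head = (\<lambda>e. if e \<in> ?I then head D' e else head D'' e)\<rparr>"
    have ext: "extends D D'" "extends D D''"
      using D' D'' I by (auto simp: orients_def extends_def D_def H)
    have "balance D v = balance D' v + balance D'' v" for v
      using ext D'(1) D''(1) I fin
      by (intro balance_disjoint_union) (auto simp: orients_def D_def H)
    \<comment> \<open>No edge of \<open>?H\<close> meets \<open>z\<close>, so the balance of
      \<open>D\<close> at \<open>z\<close> comes from \<open>D'\<close> alone.\<close>
    moreover have "balance D'' z = 0"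
      by (rule balance_not_vertex[OF finite_loopless_remove_vertex[OF G] subset_refl D''(1)])
        (simp add: H)
    ultimately have "balance D v = \<beta> v" if "v \<in> vertices G" for v
      using D'(2) D''(2) that by (cases "v = z") (auto simp: H)
    moreover have "orients D G (edges G)"
      using D'(1) D''(1) by (auto simp: orients_def D_def H)
    ultimately show "\<exists>D. beta_orientation G \<beta> D \<and> extends D D'"
      using ext(1) by (auto simp: beta_orientation_def)
  qed
qed

text \<open>The degree condition provides a pre-orientation whose balance at \<open>z\<close> is
  \<open>\<beta> z\<close>; extendability then completes it.\<close>

lemma Z3_connected_if_extendable_at:
  assumes G: "finite_loopless G" and ext: "Z3_extendable_at G z"
    and deg: "vertices G = {z} \<or> 2 \<le> card (incident_edges G z)"
  shows "Z3_connected G"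
  unfolding Z3_connected_def
proof (intro allI impI)
  fix \<beta> assume \<beta>: "zero_sum G \<beta>"
  have "\<exists>D. orients D G (incident_edges G z) \<and> balance D z = \<beta> z"
    using deg
  proof
    \<comment> \<open>A single vertex without loops has no edges, and zero-sum forces
      \<open>\<beta> z = 0\<close>, so the empty pre-orientation fits.\<close>
    assume V: "vertices G = {z}"
    have "edges G = {}"
    proof (rule ccontr)
      assume "edges G \<noteq> {}"
      then obtain e where "ends G e \<subseteq> {z}" "card (ends G e) = 2"
        using G V by (auto simp: finite_loopless_def)
      then show False
        using card_mono[of "{z}" "ends G e"] by simp
    qed
    then have "incident_edges G z = {}"
      by (simp add: incident_edges_def)
    then show ?thesis
      using star_orientation_exists[OF G empty_subsetI, of z] \<beta> V by (simp add: zero_sum_def)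
  next
    assume "2 \<le> card (incident_edges G z)"
    then show ?thesis
      by (rule star_orientation_with_balance[OF G])
  qed
  then show "\<exists>D. beta_orientation G \<beta> D"
    using ext \<beta> unfolding Z3_extendable_at_def by blast
qed

text \<open>The second part carries a degree condition because
  \<open>extendable_not_connected_example\<close> refutes the bare implication; by
  \<open>Z3_connected_imp_degree\<close> every connected \<open>G\<close> satisfies this
  condition.\<close>

theorem proposition1p4:
  fixes G :: "('v, 'e) multigraph" and z\<^sub>0 :: 'v
  assumes "finite_loopless G" and "z\<^sub>0 \<in> vertices G"
  shows "(Z3_extendable_at G z\<^sub>0 \<longleftrightarrow> Z3_connected (remove_vertex G z\<^sub>0)) \<and>
    (vertices G = {z\<^sub>0} \<or> 2 \<le> card (incident_edges G z\<^sub>0) \<longrightarrow>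
      Z3_extendable_at G z\<^sub>0 \<longrightarrow> Z3_connected G)"
  using Z3_extendable_at_iff[OF assms] Z3_connected_if_extendable_at[OF assms(1)] by blast

end
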